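(* Let $H$ be a Hilbert space and let $T \in B(H)$ be an EP operator. Then $\gamma(T) \leq r(T)$, where $\gamma(T)$ is the reduced minimum modulus of $T$ and $r(T)$ is the spectral radius of $T$.
   Context: Hilbert spaces are complex. $B(H)$ is the set of bounded linear operators on $H$. $N(T)$ and $R(T)$ denote the null space and the range of $T$. An operator $T\in B(H)$ is called EP if $R(T)$ is closed and $R(T)=R(T^* )$. The reduced minimum modulus of a nonzero $T\in B(H)$ is $\gamma(T)=\inf\{\|Tx\|/\|x\| : x\in N(T)^\perp,\ x\neq 0\}$; for the zero operator the convention $\gamma(0)=0$ is used. *)

theory Defs
  imports Complex_Main
begin

class complex_vector = real_vector +
  fixes scaleC :: "complex \<Rightarrow> 'a \<Rightarrow> 'a" (infixr \<open>*\<^sub>C\<close> 75)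
  assumes scaleC_add_right: "a *\<^sub>C (x + y) = a *\<^sub>C x + a *\<^sub>C y"
    and scaleC_add_left: "(a + b) *\<^sub>C x = a *\<^sub>C x + b *\<^sub>C x"
    and scaleC_scaleC: "a *\<^sub>C (b *\<^sub>C x) = (a * b) *\<^sub>C x"
    and scaleC_one: "1 *\<^sub>C x = x"
    and scaleR_scaleC: "r *\<^sub>R x = complex_of_real r *\<^sub>C x"

text \<open>The inner product is linear in the first and conjugate linear in the second argument.\<close>

class complex_inner = complex_vector + real_normed_vector +
  fixes cinner :: "'a \<Rightarrow> 'a \<Rightarrow> complex"
  assumes cinner_commute: "cinner x y = cnj (cinner y x)"
    and cinner_add_left: "cinner (x + y) z = cinner x z + cinner y z"
    and cinner_scaleC_left: "cinner (a *\<^sub>C x) y = a * cinner x y"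
    and cinner_self: "cinner x x = complex_of_real ((norm x)\<^sup>2)"

class chilbert_space = complex_inner + complete_space

instantiation complex :: chilbert_space
begin

definition scaleC_complex :: "complex \<Rightarrow> complex \<Rightarrow> complex"
  where "scaleC_complex a x = a * x"

definition cinner_complex :: "complex \<Rightarrow> complex \<Rightarrow> complex"
  where "cinner_complex x y = x * cnj y"

instance
proof
  fix a b x y z :: complex and r :: real
  show "a *\<^sub>C (x + y) = a *\<^sub>C x + a *\<^sub>C y"
    unfolding scaleC_complex_def by (rule distrib_left)
  show "(a + b) *\<^sub>C x = a *\<^sub>C x + b *\<^sub>C x"
    unfolding scaleC_complex_def by (rule distrib_right)
  show "a *\<^sub>C (b *\<^sub>C x) = (a * b) *\<^sub>C x"
    unfolding scaleC_complex_def by (rule mult.assoc [symmetric])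
  show "1 *\<^sub>C x = x"
    unfolding scaleC_complex_def by (rule mult_1_left)
  show "r *\<^sub>R x = complex_of_real r *\<^sub>C x"
    unfolding scaleC_complex_def by (rule scaleR_conv_of_real)
  show "cinner x y = cnj (cinner y x)"
    unfolding cinner_complex_def by simp
  show "cinner (x + y) z = cinner x z + cinner y z"
    unfolding cinner_complex_def by (rule distrib_right)
  show "cinner (a *\<^sub>C x) y = a * cinner x y"
    unfolding cinner_complex_def scaleC_complex_def by (rule mult.assoc)
  show "cinner x x = complex_of_real ((norm x)\<^sup>2)"
    unfolding cinner_complex_def by (rule complex_norm_square [symmetric])
qed

end

text \<open>Elements of \<open>B(H)\<close> are represented as functions satisfying the following predicate.\<close>

locale bounded_clinear = bounded_linear T
  for T :: "'a::complex_inner \<Rightarrow> 'b::complex_inner" +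
  assumes scaleC: "T (a *\<^sub>C x) = a *\<^sub>C T x"

text \<open>For bounded \<open>T\<close> on a Hilbert space, existence of the adjoint is the Riesz representation
  theorem; uniqueness is immediate from definiteness of the inner product.\<close>

definition cadjoint :: "('a::chilbert_space \<Rightarrow> 'a) \<Rightarrow> 'a \<Rightarrow> 'a"
  where "cadjoint T = (THE S. \<forall>x y. cinner (T x) y = cinner x (S y))"

definition EP_operator :: "('a::chilbert_space \<Rightarrow> 'a) \<Rightarrow> bool"
  where "EP_operator T \<longleftrightarrow>
    bounded_clinear T \<and> closed (range T) \<and> range T = range (cadjoint T)"

definition null_space :: "('a::chilbert_space \<Rightarrow> 'a) \<Rightarrow> 'a set"
  where "null_space T = {x. T x = 0}"

definition ortho_compl :: "'a::chilbert_space set \<Rightarrow> 'a set"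
  where "ortho_compl M = {x. \<forall>y\<in>M. cinner x y = 0}"

definition reduced_min_modulus :: "('a::chilbert_space \<Rightarrow> 'a) \<Rightarrow> real"
  where "reduced_min_modulus T =
    (if T = (\<lambda>x. 0) then 0
     else Inf {norm (T x) / norm x | x. x \<in> ortho_compl (null_space T) \<and> x \<noteq> 0})"

definition op_spectrum :: "('a::chilbert_space \<Rightarrow> 'a) \<Rightarrow> complex set"
  where "op_spectrum T =
    {l. \<nexists>S. bounded_clinear S \<and>
        (\<forall>x. S (T x - l *\<^sub>C x) = x) \<and> (\<forall>x. T (S x) - l *\<^sub>C S x = x)}"

text \<open>The spectrum of a bounded operator is empty only on the zero space, where the spectral
  radius is taken to be 0 (\<open>Sup {}\<close> is unspecified for reals).\<close>

definition op_spectral_radius :: "('a::chilbert_space \<Rightarrow> 'a) \<Rightarrow> real"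
  where "op_spectral_radius T =
    (if op_spectrum T = {} then 0 else Sup (cmod ` op_spectrum T))"

end

theory Submission
  imports Defs "HOL-Complex_Analysis.Cauchy_Integral_Formula"
begin

text \<open>
  Let \<open>M = R(T)\<close>. Because \<open>R(T) = R(T\<^sup>*)\<close>, the space is the orthogonal sum of \<open>M\<close> and \<open>N(T)\<close>.
  Hence \<open>T\<close> maps \<open>M\<close> onto itself (\<open>EP_maps_range_onto_range\<close>), and since \<open>M\<close> is
  contained in \<open>N(T)\<^sup>\<bottom>\<close>, it satisfies \<open>\<parallel>T u\<parallel> \<ge> \<gamma>(T) \<parallel>u\<parallel>\<close> there. If \<open>\<gamma>(T) > 0\<close>, the
  restriction of \<open>T\<close> to \<open>M\<close> is therefore invertible with an inverse of norm at most
  \<open>1 / \<gamma>(T)\<close>, so the disc \<open>\<bar>l\<bar> < \<gamma>(T)\<close> is free of spectrum of this restriction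
  (\<open>boundedly_bijective_on_perturbation\<close>). The spectrum of the restriction is not empty, by
  Liouville's theorem (\<open>exists_not_boundedly_bijective_on\<close>), and thus has a point \<open>l\<close> with
  \<open>\<bar>l\<bar> \<ge> \<gamma>(T)\<close>. As \<open>l \<noteq> 0\<close>, a solution \<open>u\<close> of \<open>T u - l u = v\<close> with \<open>v \<in> M\<close> lies in \<open>M\<close> itself,
  so \<open>l\<close> also belongs to the spectrum of \<open>T\<close>. That spectrum is bounded, and so \<open>r(T) \<ge> \<gamma>(T)\<close>.
  If \<open>\<gamma>(T) \<le> 0\<close>, the inequality is just \<open>r(T) \<ge> 0\<close>.

  The argument works with bounded bijections of a subspace onto itself rather than with the
  spectrum of an operator on \<open>M\<close>, because \<open>M\<close> is a set and not a type.
\<close>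

section \<open>Complex inner products\<close>

lemma scaleC_zero_left [simp]: "0 *\<^sub>C x = (0::'a::complex_vector)"
  using scaleR_scaleC[of 0 x] by simp

lemma scaleC_zero_right [simp]: "a *\<^sub>C 0 = (0::'a::complex_vector)"
  using scaleC_add_right[of a 0 "0::'a"] by simp

lemma scaleC_minus_right: "a *\<^sub>C (- x) = - (a *\<^sub>C (x::'a::complex_vector))"
  using scaleC_add_right[of a x "- x"] by (simp add: eq_neg_iff_add_eq_0 add.commute)

lemma scaleC_diff_right: "a *\<^sub>C (x - y) = a *\<^sub>C x - a *\<^sub>C (y::'a::complex_vector)"
  using scaleC_add_right[of a x "- y"] by (simp add: scaleC_minus_right)

lemma scaleC_diff_left: "(a - b) *\<^sub>C x = a *\<^sub>C x - b *\<^sub>C (x::'a::complex_vector)"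
  using scaleC_add_left[of "a - b" b x] by (simp add: algebra_simps)

lemma scaleC_minus_left: "(- a) *\<^sub>C x = - (a *\<^sub>C (x::'a::complex_vector))"
  using scaleC_diff_left[of 0 a x] by simp

lemma cinner_zero_left [simp]: "cinner 0 (y::'a::complex_inner) = 0"
  using cinner_add_left[of 0 0 y] by simp

lemma cinner_minus_left: "cinner (- x) (y::'a::complex_inner) = - cinner x y"
  using cinner_add_left[of x "- x" y] by (simp add: eq_neg_iff_add_eq_0 add.commute)

lemma cinner_diff_left: "cinner (x - y) (z::'a::complex_inner) = cinner x z - cinner y z"
  using cinner_add_left[of x "- y" z] by (simp add: cinner_minus_left)

lemma cinner_add_right: "cinner (x::'a::complex_inner) (y + z) = cinner x y + cinner x z"
  by (metis cinner_commute cinner_add_left complex_cnj_add)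

lemma cinner_diff_right: "cinner (x::'a::complex_inner) (y - z) = cinner x y - cinner x z"
  by (metis cinner_commute cinner_diff_left complex_cnj_diff)

lemma cinner_scaleC_right: "cinner (x::'a::complex_inner) (a *\<^sub>C y) = cnj a * cinner x y"
  by (metis cinner_commute cinner_scaleC_left complex_cnj_mult)

lemma cinner_zero_right [simp]: "cinner (x::'a::complex_inner) 0 = 0"
  using cinner_add_right[of x 0 0] by simp

lemma cinner_self_eq_0_iff [simp]: "cinner x x = 0 \<longleftrightarrow> (x::'a::complex_inner) = 0"
  by (simp add: cinner_self)

lemma norm_scaleC [simp]: "norm (a *\<^sub>C x) = cmod a * norm (x::'a::complex_inner)"
proof -
  have "complex_of_real ((norm (a *\<^sub>C x))\<^sup>2) = a * cnj a * complex_of_real ((norm x)\<^sup>2)"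
    by (metis cinner_self cinner_scaleC_left cinner_scaleC_right mult.assoc)
  also have "\<dots> = complex_of_real ((cmod a * norm x)\<^sup>2)"
    by (simp add: complex_norm_square[symmetric] power_mult_distrib)
  finally have "(norm (a *\<^sub>C x))\<^sup>2 = (cmod a * norm x)\<^sup>2"
    by (simp only: of_real_eq_iff)
  then show ?thesis by (simp add: power2_eq_iff_nonneg)
qed

lemma norm_add_square:
  "(norm (x + y))\<^sup>2 = (norm x)\<^sup>2 + (norm y)\<^sup>2 + 2 * Re (cinner x (y::'a::complex_inner))"
proof -
  have "complex_of_real ((norm (x + y))\<^sup>2) = cinner x x + cinner y y + (cinner x y + cnj (cinner x y))"
    unfolding cinner_self[symmetric]
    by (simp add: cinner_add_left cinner_add_right cinner_commute[of y x])
  also have "\<dots> = complex_of_real ((norm x)\<^sup>2 + (norm y)\<^sup>2 + 2 * Re (cinner x y))"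
    by (simp add: cinner_self complex_add_cnj)
  finally show ?thesis by (simp only: of_real_eq_iff)
qed

lemma norm_diff_square:
  "(norm (x - y))\<^sup>2 = (norm x)\<^sup>2 + (norm y)\<^sup>2 - 2 * Re (cinner x (y::'a::complex_inner))"
  using norm_add_square[of x "- y"] cinner_diff_right[of x 0 y] by simp

lemma parallelogram_law:
  "(norm (x + y))\<^sup>2 + (norm (x - y))\<^sup>2 = 2 * (norm x)\<^sup>2 + 2 * (norm (y::'a::complex_inner))\<^sup>2"
  by (simp add: norm_add_square norm_diff_square)

text \<open>Pythagoras for the component of \<open>x\<close> along \<open>y\<close>. That the left-hand side is nonnegative gives
  the Cauchy--Schwarz inequality; that it is smaller than \<open>\<parallel>x\<parallel>\<^sup>2\<close> unless \<open>x\<close> is orthogonal to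
  \<open>y\<close> shows that closest points are orthogonal projections.\<close>

lemma norm_remove_component_square:
  fixes x y :: "'a::complex_inner"
  assumes "y \<noteq> 0"
  shows "(norm (x - (cinner x y / complex_of_real ((norm y)\<^sup>2)) *\<^sub>C y))\<^sup>2
    = (norm x)\<^sup>2 - (cmod (cinner x y))\<^sup>2 / (norm y)\<^sup>2"
proof -
  define a where "a = cinner x y / complex_of_real ((norm y)\<^sup>2)"
  have n: "norm y > 0" using assms by simp
  have "cinner x (a *\<^sub>C y) = complex_of_real ((cmod (cinner x y))\<^sup>2 / (norm y)\<^sup>2)"
    unfolding a_def cinner_scaleC_right of_real_divide complex_norm_square by simp
  then have "Re (cinner x (a *\<^sub>C y)) = (cmod (cinner x y))\<^sup>2 / (norm y)\<^sup>2" by simp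
  moreover have "norm (a *\<^sub>C y) = cmod (cinner x y) / norm y"
    unfolding norm_scaleC a_def norm_divide norm_of_real using n by (simp add: power2_eq_square)
  ultimately have "(norm (x - a *\<^sub>C y))\<^sup>2 = (norm x)\<^sup>2 - (cmod (cinner x y))\<^sup>2 / (norm y)\<^sup>2"
    by (simp add: norm_diff_square power_divide)
  then show ?thesis by (simp only: a_def)
qed

lemma Cauchy_Schwarz_cinner: "cmod (cinner x y) \<le> norm x * norm (y::'a::complex_inner)"
proof (cases "y = 0")
  case False
  then have "0 \<le> (norm x)\<^sup>2 - (cmod (cinner x y))\<^sup>2 / (norm y)\<^sup>2"
    by (metis norm_remove_component_square zero_le_power2)
  then have "(cmod (cinner x y))\<^sup>2 \<le> (norm x * norm y)\<^sup>2"
    using False by (simp add: field_simps)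
  then show ?thesis by (rule power2_le_imp_le) simp
qed simp

section \<open>Orthogonal projection and adjoints\<close>

definition csubspace :: "'a::complex_vector set \<Rightarrow> bool"
  where "csubspace M \<longleftrightarrow>
    0 \<in> M \<and> (\<forall>x\<in>M. \<forall>y\<in>M. x + y \<in> M) \<and> (\<forall>a. \<forall>x\<in>M. a *\<^sub>C x \<in> M)"

lemma csubspaceD:
  assumes "csubspace M"
  shows "0 \<in> M" "x \<in> M \<Longrightarrow> y \<in> M \<Longrightarrow> x + y \<in> M" "x \<in> M \<Longrightarrow> a *\<^sub>C x \<in> M"
    "x \<in> M \<Longrightarrow> y \<in> M \<Longrightarrow> x - y \<in> M"
proof -
  show *: "0 \<in> M" "x \<in> M \<Longrightarrow> y \<in> M \<Longrightarrow> x + y \<in> M" "x \<in> M \<Longrightarrow> a *\<^sub>C x \<in> M" for x y a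
    using assms by (auto simp: csubspace_def)
  show "x \<in> M \<Longrightarrow> y \<in> M \<Longrightarrow> x - y \<in> M"
    using *(2)[of x "(-1) *\<^sub>C y"] *(3)[of y "-1"] by (simp add: scaleC_minus_left scaleC_one)
qed

lemma csubspace_UNIV [simp]: "csubspace UNIV"
  by (simp add: csubspace_def)

lemma csubspace_range:
  assumes "bounded_clinear T"
  shows "csubspace (range T)"
proof -
  interpret bounded_clinear T by fact
  show ?thesis
    unfolding csubspace_def
    by (auto simp: image_iff simp flip: add scaleC intro: zero)
qed

lemma orthogonal_if_closest:
  fixes z :: "'a::complex_inner"
  assumes "csubspace M" and closest: "\<And>m. m \<in> M \<Longrightarrow> norm z \<le> norm (z - m)" and m: "m \<in> M"
  shows "cinner z m = 0"
proof (cases "m = 0")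
  case False
  have "(norm z)\<^sup>2 \<le> (norm (z - (cinner z m / complex_of_real ((norm m)\<^sup>2)) *\<^sub>C m))\<^sup>2"
    using closest csubspaceD(3)[OF assms(1) m] by (simp add: power_mono)
  then have "(cmod (cinner z m))\<^sup>2 / (norm m)\<^sup>2 \<le> 0"
    unfolding norm_remove_component_square[OF False] by linarith
  then show ?thesis using False by (simp add: divide_le_0_iff)
qed simp

text \<open>A sequence in \<open>M\<close> whose distance to \<open>x\<close> tends to the infimum is Cauchy: by the
  parallelogram law, two almost closest points that are far apart would have a midpoint closer
  to \<open>x\<close> than the infimum allows. Its limit is the closest point.\<close>

lemma orthogonal_projection_exists:
  fixes M :: "'a::chilbert_space set"
  assumes M: "csubspace M" and "closed M"
  obtains p where "p \<in> M" "\<And>m. m \<in> M \<Longrightarrow> cinner (x - p) m = 0"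
proof -
  define d where "d = infdist x M"
  have ne: "M \<noteq> {}" using csubspaceD(1)[OF M] by auto
  have d0: "0 \<le> d" by (simp add: d_def infdist_nonneg)
  have d: "d \<le> norm (x - m)" if "m \<in> M" for m
    using infdist_le[OF that, of x] by (simp add: d_def dist_norm)
  have "\<exists>m\<in>M. norm (x - m) < d + 1 / real (Suc n)" for n
  proof -
    have "Inf (dist x ` M) < d + 1 / real (Suc n)"
      using ne by (simp add: d_def infdist_def)
    then show ?thesis
      using ne by (subst (asm) cInf_less_iff) (auto simp: dist_norm intro!: bdd_belowI[of _ 0])
  qed
  then obtain s where s: "\<And>n. s n \<in> M" "\<And>n. norm (x - s n) < d + 1 / real (Suc n)"
    by metis
  have lim: "(\<lambda>n. norm (x - s n)) \<longlonglongrightarrow> d"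
  proof (rule tendsto_sandwich[where f = "\<lambda>_. d"])
    show "(\<lambda>n. d + 1 / real (Suc n)) \<longlonglongrightarrow> d"
      using tendsto_add[OF tendsto_const LIMSEQ_Suc[OF lim_1_over_n], of d] by simp
    show "\<forall>\<^sub>F n in sequentially. d \<le> norm (x - s n)"
      by (intro always_eventually allI d s(1))
    show "\<forall>\<^sub>F n in sequentially. norm (x - s n) \<le> d + 1 / real (Suc n)"
      by (intro always_eventually allI less_imp_le s(2))
  qed (rule tendsto_const)
  have close: "(norm (s m - s n))\<^sup>2 \<le> 2 * ((norm (x - s m))\<^sup>2 - d\<^sup>2) + 2 * ((norm (x - s n))\<^sup>2 - d\<^sup>2)"
    for m n
  proof -
    define h where "h = (1/2) *\<^sub>C (s m + s n)"
    have "h \<in> M" unfolding h_def using s(1) csubspaceD[OF M] by blast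
    have "h + h = s m + s n"
      by (simp add: h_def flip: scaleC_add_left) (simp add: scaleC_one)
    then have eq: "(x - s m) + (x - s n) = 2 *\<^sub>R (x - h)"
      by (simp add: scaleR_2 algebra_simps)
    have "d\<^sup>2 \<le> (norm (x - h))\<^sup>2"
      using d[OF \<open>h \<in> M\<close>] d0 by (simp add: power_mono)
    moreover have "(norm ((x - s m) + (x - s n)))\<^sup>2 = 4 * (norm (x - h))\<^sup>2"
      unfolding eq by (simp add: power_mult_distrib)
    moreover have "norm ((x - s m) - (x - s n)) = norm (s m - s n)"
      by (simp add: norm_minus_commute)
    ultimately show ?thesis
      using parallelogram_law[of "x - s m" "x - s n"] by simp
  qed
  have "Cauchy s"
  proof (rule metric_CauchyI)
    fix e :: real assume e: "0 < e"
    have "(\<lambda>n. (norm (x - s n))\<^sup>2 - d\<^sup>2) \<longlonglongrightarrow> d\<^sup>2 - d\<^sup>2"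
      by (intro tendsto_intros lim)
    then have "\<forall>\<^sub>F n in sequentially. (norm (x - s n))\<^sup>2 - d\<^sup>2 < e\<^sup>2 / 4"
      using e by (intro order_tendstoD(2)) auto
    then obtain N where N: "\<And>n. n \<ge> N \<Longrightarrow> (norm (x - s n))\<^sup>2 - d\<^sup>2 < e\<^sup>2 / 4"
      by (auto simp: eventually_sequentially)
    have "dist (s m) (s n) < e" if "m \<ge> N" "n \<ge> N" for m n
    proof -
      have "(norm (s m - s n))\<^sup>2 < e\<^sup>2"
        by (rule le_less_trans[OF close[of m n]])
          (use add_strict_mono[OF N[OF that(1)] N[OF that(2)]] in \<open>simp add: field_simps\<close>)
      then show ?thesis using e by (simp add: dist_norm power2_less_imp_less)
    qed
    then show "\<exists>N. \<forall>m\<ge>N. \<forall>n\<ge>N. dist (s m) (s n) < e" by blast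
  qed
  then obtain p where p: "s \<longlonglongrightarrow> p" using Cauchy_convergent convergent_def by blast
  have "p \<in> M" using closed_sequentially[OF \<open>closed M\<close> s(1) p] .
  have "(\<lambda>n. norm (x - s n)) \<longlonglongrightarrow> norm (x - p)" by (intro tendsto_intros p)
  then have "norm (x - p) = d" using lim LIMSEQ_unique by blast
  then have "norm (x - p) \<le> norm ((x - p) - m)" if "m \<in> M" for m
    using d[OF csubspaceD(2)[OF M \<open>p \<in> M\<close> that]] by (simp add: algebra_simps)
  then have "cinner (x - p) m = 0" if "m \<in> M" for m
    using orthogonal_if_closest[OF M _ that] by blast
  then show thesis using that \<open>p \<in> M\<close> by blast
qed

text \<open>The orthogonal complement of the kernel of a nonzero functional is spanned by one vector
  \<open>z\<close>, and a suitable multiple of \<open>z\<close> represents the functional.\<close>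

lemma Riesz_representation:
  fixes \<phi> :: "'a::chilbert_space \<Rightarrow> complex"
  assumes "bounded_clinear \<phi>"
  obtains y where "\<And>x. \<phi> x = cinner x y"
proof (cases "\<forall>x. \<phi> x = 0")
  case True
  then show thesis using that[of 0] by simp
next
  case False
  interpret bounded_clinear \<phi> by fact
  have hom: "\<phi> (a *\<^sub>C x) = a * \<phi> x" for a x by (simp add: scaleC scaleC_complex_def)
  define M where "M = {x. \<phi> x = 0}"
  have "csubspace M" by (auto simp: csubspace_def M_def add hom zero)
  have "closed M" unfolding M_def
    by (intro closed_Collect_eq continuous_on_const continuous_on continuous_on_id)
  from False obtain x0 where "\<phi> x0 \<noteq> 0" by blast
  obtain p where p: "p \<in> M" "\<And>m. m \<in> M \<Longrightarrow> cinner (x0 - p) m = 0"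
    using orthogonal_projection_exists[OF \<open>csubspace M\<close> \<open>closed M\<close>] by metis
  define z where "z = x0 - p"
  have z: "\<phi> z \<noteq> 0" using p(1) \<open>\<phi> x0 \<noteq> 0\<close> by (simp add: z_def M_def diff)
  then have "z \<noteq> 0" using zero by auto
  have "\<phi> x = cinner x (cnj (\<phi> z / cinner z z) *\<^sub>C z)" for x
  proof -
    have "x - (\<phi> x / \<phi> z) *\<^sub>C z \<in> M" using z by (simp add: M_def diff hom)
    then have "cinner (x - (\<phi> x / \<phi> z) *\<^sub>C z) z = 0"
      using p(2) by (metis cinner_commute complex_cnj_zero z_def)
    then show ?thesis using z \<open>z \<noteq> 0\<close>
      by (simp add: cinner_diff_left cinner_scaleC_left cinner_scaleC_right)
  qed
  then show thesis by (rule that)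
qed

text \<open>The adjoint is a definite description, so its defining property depends on existence, by
  Riesz representation of \<open>x \<mapsto> \<langle>T x, y\<rangle>\<close>, and on uniqueness.\<close>

lemma cinner_cadjoint:
  fixes T :: "'a::chilbert_space \<Rightarrow> 'a"
  assumes "bounded_clinear T"
  shows "cinner (T x) y = cinner x (cadjoint T y)"
proof -
  interpret bounded_clinear T by fact
  have "\<exists>w. \<forall>x. cinner (T x) y = cinner x w" for y
  proof -
    obtain K where K: "\<And>x. norm (T x) \<le> norm x * K" using bounded by blast
    have "bounded_clinear (\<lambda>x. cinner (T x) y)"
    proof
      show "\<exists>K. \<forall>x. norm (cinner (T x) y) \<le> norm x * K"
      proof (intro exI allI)
        fix x
        have "cmod (cinner (T x) y) \<le> norm (T x) * norm y" by (rule Cauchy_Schwarz_cinner)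
        also have "\<dots> \<le> norm x * K * norm y" using K by (simp add: mult_right_mono)
        finally show "norm (cinner (T x) y) \<le> norm x * (K * norm y)" by (simp add: mult.assoc)
      qed
    qed (simp_all add: add scaleR scaleC cinner_add_left cinner_scaleC_left scaleR_scaleC
        scaleC_complex_def)
    then show ?thesis using Riesz_representation by metis
  qed
  then obtain S where S: "\<forall>x y. cinner (T x) y = cinner x (S y)" by metis
  have "\<forall>x y. cinner (T x) y = cinner x (cadjoint T y)"
    unfolding cadjoint_def
  proof (rule theI[where P = "\<lambda>S. \<forall>x y. cinner (T x) y = cinner x (S y)", OF S])
    fix S' assume S': "\<forall>x y. cinner (T x) y = cinner x (S' y)"
    have "cinner (S' y - S y) (S' y - S y) = 0" for y
      using S S' by (metis cinner_diff_right diff_self)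
    then show "S' = S" by (auto simp: fun_eq_iff)
  qed
  then show ?thesis by blast
qed

section \<open>Operators with bounded inverse on an invariant subspace\<close>

definition bounded_below_on :: "'a::real_normed_vector set \<Rightarrow> real \<Rightarrow> ('a \<Rightarrow> 'a) \<Rightarrow> bool"
  where "bounded_below_on M c B \<longleftrightarrow> c > 0 \<and> (\<forall>u\<in>M. c * norm u \<le> norm (B u))"

text \<open>If \<open>M\<close> is a \<open>T\<close>-invariant closed subspace, the numbers \<open>l\<close> for which \<open>T - l\<close> is not
  boundedly bijective on \<open>M\<close> form the spectrum of the restriction of \<open>T\<close> to \<open>M\<close>. The lower bound
  both gives injectivity of a linear \<open>B\<close> and bounds its inverse.\<close>

definition boundedly_bijective_on :: "'a::real_normed_vector set \<Rightarrow> ('a \<Rightarrow> 'a) \<Rightarrow> bool"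
  where "boundedly_bijective_on M B \<longleftrightarrow> (\<exists>c. bounded_below_on M c B) \<and> B ` M = M"

lemma bounded_clinear_scaleC: "bounded_clinear (\<lambda>x::'a::complex_inner. l *\<^sub>C x)"
proof
  show "\<exists>K. \<forall>x::'a. norm (l *\<^sub>C x) \<le> norm x * K"
    by (intro exI[of _ "cmod l"]) simp
qed (simp_all add: scaleC_add_right scaleC_scaleC scaleR_scaleC mult.commute)

lemma bounded_clinear_diff:
  assumes "bounded_clinear B" "bounded_clinear C"
  shows "bounded_clinear (\<lambda>x. B x - C x)"
proof -
  interpret B: bounded_clinear B by fact
  interpret C: bounded_clinear C by fact
  interpret bounded_linear "\<lambda>x. B x - C x"
    by (intro bounded_linear_sub B.bounded_linear_axioms C.bounded_linear_axioms)
  show ?thesis by standard (simp add: B.scaleC C.scaleC scaleC_diff_right)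
qed

text \<open>A perturbation smaller than the lower bound preserves invertibility: \<open>B u - C u = x\<close> is the
  fixed point equation \<open>u = B\<^sup>-\<^sup>1 (x + C u)\<close>, whose right-hand side is a contraction with
  constant \<open>k / c\<close>.\<close>

lemma boundedly_bijective_on_perturbation:
  fixes B :: "'a::chilbert_space \<Rightarrow> 'a"
  assumes M: "csubspace M" and "closed M"
    and B: "bounded_clinear B" "B ` M = M" "bounded_below_on M c B"
    and C: "bounded_clinear C" "C ` M \<subseteq> M"
    and k: "0 \<le> k" "k < c" "\<And>u. u \<in> M \<Longrightarrow> norm (C u) \<le> k * norm u"
  shows "boundedly_bijective_on M (\<lambda>u. B u - C u)"
proof -
  interpret B: bounded_clinear B by fact
  interpret C: bounded_clinear C by fact
  have c: "c > 0" and below: "\<And>u. u \<in> M \<Longrightarrow> c * norm u \<le> norm (B u)"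
    using B(3) by (auto simp: bounded_below_on_def)
  have "(c - k) * norm u \<le> norm (B u - C u)" if "u \<in> M" for u
    using below[OF that] k(3)[OF that] norm_triangle_ineq2[of "B u" "C u"]
    by (simp add: algebra_simps)
  then have below': "bounded_below_on M (c - k) (\<lambda>u. B u - C u)"
    using k by (simp add: bounded_below_on_def)
  have surj: "x \<in> (\<lambda>u. B u - C u) ` M" if x: "x \<in> M" for x
  proof -
    define G where "G u = inv_into M B (x + C u)" for u
    have G: "G u \<in> M" "B (G u) = x + C u" if "u \<in> M" for u
    proof -
      have "x + C u \<in> B ` M" using x that C(2) csubspaceD(2)[OF M] B(2) by auto
      then show "G u \<in> M" "B (G u) = x + C u"
        by (simp_all add: G_def inv_into_into f_inv_into_f)
    qed
    have "\<exists>!u\<in>M. G u = u"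
    proof (rule Banach_fix[where c = "k / c"])
      show "complete M" using \<open>closed M\<close> complete_eq_closed by blast
      show "M \<noteq> {}" using x by auto
      show "dist (G u) (G v) \<le> k / c * dist u v" if u: "u \<in> M" and v: "v \<in> M" for u v
      proof -
        have "c * norm (G u - G v) \<le> norm (B (G u - G v))"
          by (intro below csubspaceD(4)[OF M] G u v)
        also have "B (G u - G v) = C (u - v)"
          using G u v by (simp add: B.diff C.diff)
        also have "norm \<dots> \<le> k * norm (u - v)"
          by (intro k csubspaceD(4)[OF M] u v)
        finally show ?thesis
          using c by (simp add: dist_norm field_simps)
      qed
    qed (use k c G in auto)
    then obtain u where "u \<in> M" "G u = u" by blast
    then have "x = B u - C u" using G(2)[of u] by simp
    then show ?thesis using \<open>u \<in> M\<close> by (rule image_eqI)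
  qed
  have "(\<lambda>u. B u - C u) ` M \<subseteq> M"
    using B(2) C(2) by (intro image_subsetI csubspaceD(4)[OF M]) auto
  with surj have "(\<lambda>u. B u - C u) ` M = M" by blast
  with below' show ?thesis by (auto simp: boundedly_bijective_on_def)
qed

lemma notin_op_spectrum_iff:
  fixes T :: "'a::chilbert_space \<Rightarrow> 'a"
  assumes "bounded_clinear T"
  shows "l \<notin> op_spectrum T \<longleftrightarrow> boundedly_bijective_on UNIV (\<lambda>x. T x - l *\<^sub>C x)"
proof
  let ?B = "\<lambda>x. T x - l *\<^sub>C x"
  interpret B: bounded_clinear ?B
    by (intro bounded_clinear_diff assms bounded_clinear_scaleC)
  {
    assume "l \<notin> op_spectrum T"
    then obtain S where "bounded_clinear S" and SB: "\<And>x. S (?B x) = x"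
      and BS: "\<And>x. ?B (S x) = x"
      by (auto simp: op_spectrum_def)
    then interpret S: bounded_clinear S by simp
    obtain K where K: "K > 0" "\<And>x. norm (S x) \<le> norm x * K" using S.pos_bounded by blast
    have "1 / K * norm u \<le> norm (?B u)" for u
      using K(2)[of "?B u"] K(1) by (simp add: SB field_simps)
    then have "bounded_below_on UNIV (1 / K) ?B" using K(1) by (simp add: bounded_below_on_def)
    moreover have "surj ?B" using BS by (metis surjI)
    ultimately show "boundedly_bijective_on UNIV ?B" by (auto simp: boundedly_bijective_on_def)
  next
    assume "boundedly_bijective_on UNIV ?B"
    then obtain c where c: "c > 0" "\<And>u. c * norm u \<le> norm (?B u)" and "surj ?B"
      by (auto simp: boundedly_bijective_on_def bounded_below_on_def)
    have inj: "u = v" if "?B u = ?B v" for u v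
    proof -
      have "c * norm (u - v) \<le> 0" using c(2)[of "u - v"] B.diff[of u v] that by simp
      then show ?thesis using c(1) by (simp add: mult_le_0_iff)
    qed
    define S where "S = inv ?B"
    have BS: "?B (S x) = x" for x
      unfolding S_def using surj_f_inv_f[OF \<open>surj ?B\<close>, of x] .
    have SB: "S (?B x) = x" for x using BS inj by blast
    have "bounded_clinear S"
    proof
      show "S (x + y) = S x + S y" for x y by (rule inj) (simp only: B.add BS)
      show "S (r *\<^sub>R x) = r *\<^sub>R S x" for r x by (rule inj) (simp only: B.scaleR BS)
      show "S (a *\<^sub>C x) = a *\<^sub>C S x" for a x by (rule inj) (simp only: B.scaleC BS)
      show "\<exists>K. \<forall>x. norm (S x) \<le> norm x * K"
        using c(2)[of "S _"] c(1) by (intro exI[of _ "1 / c"]) (simp add: BS field_simps)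
    qed
    then show "l \<notin> op_spectrum T" using SB BS by (auto simp: op_spectrum_def)
  }
qed

text \<open>For \<open>\<bar>l\<bar> > K\<close> the operator \<open>T - l\<close> is a perturbation by \<open>- T\<close> of the bijection \<open>- l\<close>, which
  is bounded below by \<open>\<bar>l\<bar>\<close>.\<close>

lemma op_spectrum_norm_bound:
  fixes T :: "'a::chilbert_space \<Rightarrow> 'a"
  assumes T: "bounded_clinear T" and K: "0 \<le> K" "\<And>x. norm (T x) \<le> K * norm x"
    and l: "l \<in> op_spectrum T"
  shows "cmod l \<le> K"
proof (rule ccontr)
  assume "\<not> cmod l \<le> K"
  then have "K < cmod l" by simp
  then have "l \<noteq> 0" using K(1) by auto
  interpret T: bounded_clinear T by fact
  have mT: "bounded_clinear (\<lambda>x. - T x)"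
    using bounded_clinear_diff[OF bounded_clinear_scaleC[of 0] T] by simp
  have "boundedly_bijective_on UNIV (\<lambda>u. (- l) *\<^sub>C u - (- T u))"
  proof (rule boundedly_bijective_on_perturbation[where c = "cmod l" and k = K])
    show "range (\<lambda>u::'a. (- l) *\<^sub>C u) = UNIV"
      using \<open>l \<noteq> 0\<close> by (intro surjI[of _ "\<lambda>u. (- inverse l) *\<^sub>C u"])
        (simp add: scaleC_scaleC scaleC_one)
    show "bounded_below_on UNIV (cmod l) (\<lambda>u::'a. (- l) *\<^sub>C u)"
      using \<open>l \<noteq> 0\<close> by (simp add: bounded_below_on_def)
  qed (use K \<open>K < cmod l\<close> mT bounded_clinear_scaleC in auto)
  then have "boundedly_bijective_on UNIV (\<lambda>u. T u - l *\<^sub>C u)"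
    by (simp add: scaleC_minus_left)
  then show False using notin_op_spectrum_iff[OF T] l by blast
qed

lemma op_spectral_radius_ge:
  fixes T :: "'a::chilbert_space \<Rightarrow> 'a"
  assumes T: "bounded_clinear T" and l: "l \<in> op_spectrum T"
  shows "cmod l \<le> op_spectral_radius T"
proof -
  interpret bounded_clinear T by fact
  obtain K where "K > 0" "\<And>x. norm (T x) \<le> norm x * K" using pos_bounded by blast
  then have "cmod m \<le> K" if "m \<in> op_spectrum T" for m
    using op_spectrum_norm_bound[OF T _ _ that, of K] by (simp add: mult.commute)
  then have "bdd_above (cmod ` op_spectrum T)" by (auto simp: bdd_above_def)
  then show ?thesis using l by (auto simp: op_spectral_radius_def intro: cSUP_upper)
qed

lemma op_spectral_radius_nonneg:
  fixes T :: "'a::chilbert_space \<Rightarrow> 'a"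
  assumes T: "bounded_clinear T"
  shows "0 \<le> op_spectral_radius T"
proof (cases "op_spectrum T = {}")
  case True
  then show ?thesis by (simp add: op_spectral_radius_def)
next
  case False
  then obtain l where "l \<in> op_spectrum T" by blast
  then show ?thesis using op_spectral_radius_ge[OF T] norm_ge_zero order_trans by blast
qed

text \<open>Nonemptiness of the spectrum on a nonzero subspace. If \<open>T - l\<close> had a bounded inverse \<open>R l\<close>
  on \<open>M\<close> for every \<open>l\<close>, then \<open>l \<mapsto> \<langle>R l x, y\<rangle>\<close> would be entire, with derivative
  \<open>\<langle>R l (R l x), y\<rangle>\<close> by the resolvent identity, and would vanish at infinity, hence everywhere
  by Liouville's theorem. The choice \<open>y = R 0 x\<close> gives \<open>R 0 x = 0\<close> and so \<open>x = 0\<close>.\<close>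

lemma exists_not_boundedly_bijective_on:
  fixes T :: "'a::chilbert_space \<Rightarrow> 'a"
  assumes T: "bounded_clinear T" and M: "csubspace M" and "x \<in> M" "x \<noteq> 0"
  obtains l where "\<not> boundedly_bijective_on M (\<lambda>u. T u - l *\<^sub>C u)"
proof -
  interpret bounded_clinear T by fact
  have False if bij: "\<And>l. boundedly_bijective_on M (\<lambda>u. T u - l *\<^sub>C u)"
  proof -
    define R where "R l v = inv_into M (\<lambda>u. T u - l *\<^sub>C u) v" for l v
    have R: "R l v \<in> M" "T (R l v) - l *\<^sub>C R l v = v" if "v \<in> M" for l v
    proof -
      have "v \<in> (\<lambda>u. T u - l *\<^sub>C u) ` M" using that bij by (auto simp: boundedly_bijective_on_def)
      then show "R l v \<in> M" "T (R l v) - l *\<^sub>C R l v = v"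
        unfolding R_def by (rule inv_into_into, rule f_inv_into_f)
    qed
    have below: "\<exists>c>0. \<forall>u\<in>M. c * norm u \<le> norm (T u - l *\<^sub>C u)" for l
      using bij[of l] by (auto simp: boundedly_bijective_on_def bounded_below_on_def)
    have inj: "u = v" if "u \<in> M" "v \<in> M" "T u - l *\<^sub>C u = T v - l *\<^sub>C v" for u v l
    proof -
      obtain c where c: "c > 0" "\<forall>u\<in>M. c * norm u \<le> norm (T u - l *\<^sub>C u)" using below by blast
      have "u - v \<in> M" using csubspaceD(4)[OF M] that by blast
      moreover have "T (u - v) - l *\<^sub>C (u - v) = 0"
        using that(3) by (simp add: diff scaleC_diff_right algebra_simps)
      ultimately have "c * norm (u - v) \<le> 0" using c(2) by (metis norm_zero)
      then show ?thesis using c(1) by (simp add: mult_le_0_iff)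
    qed
    have resolvent: "R m v - R l v = (m - l) *\<^sub>C R m (R l v)" if v: "v \<in> M" for l m v
    proof (rule inj[of _ _ m])
      let ?w = "R m (R l v)"
      note Rl = R[OF v, of l] and Rm = R[OF v, of m] and Rml = R[OF R(1)[OF v, of l], of m]
      show "R m v - R l v \<in> M" "(m - l) *\<^sub>C ?w \<in> M"
        using csubspaceD[OF M] Rl Rm Rml by blast+
      have "T (R m v - R l v) - m *\<^sub>C (R m v - R l v)
        = (T (R m v) - m *\<^sub>C R m v) - (T (R l v) - l *\<^sub>C R l v) + (m - l) *\<^sub>C R l v"
        by (simp add: diff scaleC_diff_right scaleC_diff_left algebra_simps)
      also have "\<dots> = (m - l) *\<^sub>C (T ?w - m *\<^sub>C ?w)" using Rl Rm Rml by simp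
      also have "\<dots> = T ((m - l) *\<^sub>C ?w) - m *\<^sub>C ((m - l) *\<^sub>C ?w)"
        by (simp add: scaleC scaleC_diff_right scaleC_scaleC mult.commute)
      finally show "T (R m v - R l v) - m *\<^sub>C (R m v - R l v)
        = T ((m - l) *\<^sub>C ?w) - m *\<^sub>C ((m - l) *\<^sub>C ?w)" .
    qed
    \<comment> \<open>Within distance \<open>c / 2\<close> of \<open>l\<close> the lower bound of \<open>T - m\<close> is still at least \<open>c / 2\<close>.
      With the resolvent identity, this yields continuity of the resolvent.\<close>
    have locally_bounded: "\<exists>C. \<forall>\<^sub>F m in at l. norm (R m v) \<le> C" if v: "v \<in> M" for l v
    proof -
      obtain c where c: "c > 0" "\<forall>u\<in>M. c * norm u \<le> norm (T u - l *\<^sub>C u)" using below by blast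
      have "norm (R m v) \<le> 2 / c * norm v" if "dist m l < c / 2" for m
      proof -
        have "T (R m v) - l *\<^sub>C R m v = v + (m - l) *\<^sub>C R m v"
          using R[OF v, of m] by (simp add: scaleC_diff_left algebra_simps)
        then have "c * norm (R m v) \<le> norm (v + (m - l) *\<^sub>C R m v)"
          using c(2) R(1)[OF v, of m] by metis
        also have "\<dots> \<le> norm v + c / 2 * norm (R m v)"
          using that norm_triangle_ineq[of v "(m - l) *\<^sub>C R m v"]
            mult_right_mono[of "cmod (m - l)" "c / 2" "norm (R m v)"]
          by (simp add: dist_norm)
        finally show ?thesis using c(1) by (simp add: field_simps)
      qed
      then show ?thesis using c(1)
        by (intro exI[of _ "2 / c * norm v"]) (auto simp: eventually_at intro!: exI[of _ "c / 2"])
    qed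
    have R_tendsto: "((\<lambda>m. cinner (R m v) y) \<longlongrightarrow> cinner (R l v) y) (at l)"
      if v: "v \<in> M" for l v y
    proof -
      obtain C where C: "\<forall>\<^sub>F m in at l. norm (R m (R l v)) \<le> C"
        using locally_bounded[OF R(1)[OF v]] by blast
      have "((\<lambda>m. cinner (R m v) y - cinner (R l v) y) \<longlongrightarrow> 0) (at l)"
      proof (rule Lim_null_comparison)
        show "\<forall>\<^sub>F m in at l. norm (cinner (R m v) y - cinner (R l v) y)
          \<le> cmod (m - l) * C * norm y"
          using C
        proof eventually_elim
          case (elim m)
          have "norm (cinner (R m v) y - cinner (R l v) y) \<le> norm (R m v - R l v) * norm y"
            using Cauchy_Schwarz_cinner by (metis cinner_diff_left)
          also have "\<dots> \<le> cmod (m - l) * C * norm y"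
            unfolding resolvent[OF v] using elim by (simp add: mult_left_mono mult_right_mono)
          finally show ?case .
        qed
        have "((\<lambda>m. cmod (m - l) * C * norm y) \<longlongrightarrow> cmod (l - l) * C * norm y) (at l)"
          by (intro tendsto_intros)
        then show "((\<lambda>m. cmod (m - l) * C * norm y) \<longlongrightarrow> 0) (at l)" by simp
      qed
      then show ?thesis using Lim_null by blast
    qed
    define f where "f m = cinner (R m x) (R 0 x)" for m
    have "(f has_field_derivative cinner (R l (R l x)) (R 0 x)) (at l)" for l
      \<comment> \<open>By the resolvent identity the difference quotient is \<open>\<langle>R m (R l x), R 0 x\<rangle>\<close>.\<close>
      unfolding has_field_derivative_iff
    proof (rule Lim_transform_eventually[OF R_tendsto])
      show "R l x \<in> M" using R \<open>x \<in> M\<close> by blast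
      show "\<forall>\<^sub>F m in at l. cinner (R m (R l x)) (R 0 x) = (f m - f l) / (m - l)"
        unfolding eventually_at_filter f_def cinner_diff_left[symmetric] resolvent[OF \<open>x \<in> M\<close>]
        by (simp add: cinner_scaleC_left)
    qed
    then have "f holomorphic_on UNIV"
      by (auto simp: holomorphic_on_def field_differentiable_def)
    moreover have "(f \<longlongrightarrow> 0) at_infinity"
    proof -
      obtain K where K: "K > 0" "\<And>x. norm (T x) \<le> norm x * K" using pos_bounded by blast
      show ?thesis
      proof (rule Lim_null_comparison)
        show "\<forall>\<^sub>F m in at_infinity. norm (f m) \<le> norm x * norm (R 0 x) * inverse (cmod m - K)"
          unfolding eventually_at_infinity
        proof (intro exI[of _ "K + 1"] allI impI)
          fix m assume m: "K + 1 \<le> cmod m"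
          have "cmod m * norm (R m x) - norm (T (R m x)) \<le> norm x"
            using norm_triangle_ineq2[of "m *\<^sub>C R m x" "T (R m x)"] R(2)[OF \<open>x \<in> M\<close>, of m]
            by (simp add: norm_minus_commute)
          then have "(cmod m - K) * norm (R m x) \<le> norm x"
            using K(2)[of "R m x"] by (simp add: algebra_simps)
          then have "norm (R m x) \<le> norm x * inverse (cmod m - K)"
            using m by (simp add: field_simps)
          then have "norm (R m x) * norm (R 0 x) \<le> norm x * inverse (cmod m - K) * norm (R 0 x)"
            by (rule mult_right_mono) simp
          then show "norm (f m) \<le> norm x * norm (R 0 x) * inverse (cmod m - K)"
            using Cauchy_Schwarz_cinner[of "R m x" "R 0 x"] by (simp add: f_def mult_ac)
        qed
        have "filterlim (\<lambda>m. - K + cmod m) at_top at_infinity"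
          by (intro filterlim_tendsto_add_at_top[OF tendsto_const] filterlim_norm_at_top)
        then have "((\<lambda>m. inverse (cmod m - K)) \<longlongrightarrow> 0) at_infinity"
          by (intro tendsto_inverse_0_at_top) (simp add: algebra_simps)
        then show "((\<lambda>m. norm x * norm (R 0 x) * inverse (cmod m - K)) \<longlongrightarrow> 0) at_infinity"
          by (rule tendsto_mult_right_zero)
      qed
    qed
    ultimately have "f 0 = 0" by (rule Liouville_weak_0)
    then have "R 0 x = 0" by (simp add: f_def)
    then show False using R(2)[OF \<open>x \<in> M\<close>, of 0] \<open>x \<noteq> 0\<close> by (simp add: zero)
  qed
  then show thesis using that by blast
qed

section \<open>EP operators\<close>

text \<open>If \<open>T n = 0\<close>, then \<open>\<langle>n, T\<^sup>* y\<rangle> = \<langle>T n, y\<rangle> = 0\<close>, and \<open>R(T\<^sup>*) = R(T)\<close>.\<close>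

lemma EP_range_subset_ortho_compl:
  assumes "EP_operator T"
  shows "range T \<subseteq> ortho_compl (null_space T)"
proof -
  have "bounded_clinear T" "range T = range (cadjoint T)"
    using assms by (auto simp: EP_operator_def)
  then have "cinner n y = 0" if "T n = 0" "y \<in> range T" for n y
    using that cinner_cadjoint by (metis (no_types, lifting) cinner_zero_left imageE)
  then show ?thesis
    unfolding ortho_compl_def null_space_def by (auto intro: cinner_commute[THEN trans])
qed

text \<open>Let \<open>p\<close> be the projection of \<open>z\<close> onto \<open>R(T)\<close>. Then \<open>z - p\<close> is orthogonal to \<open>R(T) = R(T\<^sup>*)\<close>,
  hence \<open>T (z - p) = 0\<close> and \<open>T z = T p\<close>.\<close>

lemma EP_maps_range_onto_range:
  fixes T :: "'a::chilbert_space \<Rightarrow> 'a"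
  assumes "EP_operator T"
  shows "T ` range T = range T"
proof
  have T: "bounded_clinear T" and "closed (range T)" and ran: "range T = range (cadjoint T)"
    using assms by (auto simp: EP_operator_def)
  interpret bounded_clinear T by fact
  show "range T \<subseteq> T ` range T"
  proof
    fix y assume "y \<in> range T"
    then obtain z where z: "y = T z" by blast
    obtain p where p: "p \<in> range T" "\<And>m. m \<in> range T \<Longrightarrow> cinner (z - p) m = 0"
      using orthogonal_projection_exists[OF csubspace_range[OF T] \<open>closed (range T)\<close>] by metis
    have "cinner (T (z - p)) (T (z - p)) = 0"
      unfolding cinner_cadjoint[OF T] using p(2) ran by blast
    then have "T z = T p" by (simp add: diff)
    then show "y \<in> T ` range T" using z p(1) by blast
  qed
qed auto

lemma reduced_min_modulus_le:
  assumes "u \<in> ortho_compl (null_space T)" "T \<noteq> (\<lambda>x. 0)"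
  shows "reduced_min_modulus T * norm u \<le> norm (T u)"
proof (cases "u = 0")
  case False
  let ?A = "{norm (T x) / norm x | x. x \<in> ortho_compl (null_space T) \<and> x \<noteq> 0}"
  have "bdd_below ?A" by (auto intro!: bdd_belowI[of _ 0])
  then have "Inf ?A \<le> norm (T u) / norm u"
    using assms(1) False by (intro cInf_lower) auto
  then show ?thesis using assms(2) False by (simp add: reduced_min_modulus_def field_simps)
qed simp

theorem theorem3p4:
  fixes T :: "'a::chilbert_space \<Rightarrow> 'a"
  assumes "bounded_clinear T"
    and "EP_operator T"
  shows "reduced_min_modulus T \<le> op_spectral_radius T"
proof (cases "reduced_min_modulus T \<le> 0")
  case True
  then show ?thesis using op_spectral_radius_nonneg[OF assms(1)] by linarith
next
  case False
  let ?\<gamma> = "reduced_min_modulus T"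
  let ?M = "range T"
  interpret bounded_clinear T by fact
  from False have pos: "?\<gamma> > 0" by simp
  then have nz: "T \<noteq> (\<lambda>x. 0)" by (auto simp: reduced_min_modulus_def)
  have M: "csubspace ?M" by (rule csubspace_range[OF assms(1)])
  have "closed ?M" using assms(2) unfolding EP_operator_def by blast
  have below: "bounded_below_on ?M ?\<gamma> T"
    using pos reduced_min_modulus_le[OF _ nz] EP_range_subset_ortho_compl[OF assms(2)]
    unfolding bounded_below_on_def by blast
  obtain x where "x \<in> ?M" "x \<noteq> 0" using nz by (meson rangeI ext)
  then obtain l where l: "\<not> boundedly_bijective_on ?M (\<lambda>u. T u - l *\<^sub>C u)"
    using exists_not_boundedly_bijective_on[OF assms(1) M] by blast
  have "?\<gamma> \<le> cmod l"
  proof (rule ccontr)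
    assume "\<not> ?\<gamma> \<le> cmod l"
    then have "boundedly_bijective_on ?M (\<lambda>u. T u - l *\<^sub>C u)"
      by (intro boundedly_bijective_on_perturbation[OF M \<open>closed ?M\<close> assms(1)
            EP_maps_range_onto_range[OF assms(2)] below bounded_clinear_scaleC _ norm_ge_zero])
        (use csubspaceD(3)[OF M] in auto)
    with l show False by blast
  qed
  then have "l \<noteq> 0" using pos by auto
  \<comment> \<open>\<open>l\<close> lies in the spectrum of the restriction of \<open>T\<close> to its range, and hence in that of \<open>T\<close>:
    as \<open>l u = T u - v\<close>, the preimages under \<open>T - l\<close> of points in the range stay in the range.\<close>
  have "l \<in> op_spectrum T"
  proof (rule ccontr)
    assume "l \<notin> op_spectrum T"
    then have bij: "boundedly_bijective_on UNIV (\<lambda>u. T u - l *\<^sub>C u)"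
      using notin_op_spectrum_iff[OF assms(1)] by blast
    have surj: "v \<in> (\<lambda>u. T u - l *\<^sub>C u) ` ?M" if v: "v \<in> ?M" for v
    proof -
      have "v \<in> range (\<lambda>u. T u - l *\<^sub>C u)" using bij by (simp add: boundedly_bijective_on_def)
      then obtain u where u: "T u - l *\<^sub>C u = v" by blast
      have "u = inverse l *\<^sub>C (T u - v)"
        using \<open>l \<noteq> 0\<close> u[symmetric] by (simp add: scaleC_scaleC scaleC_one)
      then have "u \<in> ?M" using csubspaceD[OF M] v by (metis rangeI)
      with u[symmetric] show ?thesis by (rule image_eqI)
    qed
    have "(\<lambda>u. T u - l *\<^sub>C u) ` ?M \<subseteq> ?M"
      by (intro image_subsetI csubspaceD[OF M] rangeI)
    with surj have onto: "(\<lambda>u. T u - l *\<^sub>C u) ` ?M = ?M" by (meson subsetI subset_antisym)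
    from bij obtain c where "bounded_below_on UNIV c (\<lambda>u. T u - l *\<^sub>C u)"
      by (auto simp: boundedly_bijective_on_def)
    then have "bounded_below_on ?M c (\<lambda>u. T u - l *\<^sub>C u)"
      by (simp add: bounded_below_on_def)
    with onto have "boundedly_bijective_on ?M (\<lambda>u. T u - l *\<^sub>C u)"
      by (auto simp: boundedly_bijective_on_def)
    with l show False by blast
  qed
  then show ?thesis
    using op_spectral_radius_ge[OF assms(1)] \<open>?\<gamma> \<le> cmod l\<close> by fastforce
qed

end
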